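(* Let $A\oplus B$ be a graded vector space ($A$ in degree $0$, $B$ in degree $1$) equipped with a linear map $\partial:A\to B$ and bilinear maps $A\times B\to A$, $(a,b)\mapsto a_0b$; $B\times A\to A$, $(b,a)\mapsto b_0a$; $B\times B\to B$, $(b,b')\mapsto b_0b'$; $B\times B\to A$, $(b,b')\mapsto b_1b'$. Then $A\oplus B$ (with these operations, all other products being zero) is a $1$-truncated conformal algebra if and only if all of the following relations hold for all $a,a'\in A$ and $b,b',u,v,w\in B$: (i) $a_0\partial a'=0$; $b_0\partial a'=\partial(b_0a')$; $b_1\partial a'=b_0a'$; $(\partial a)_0a'=0$; $(\partial a)_0b=0$; $(\partial a)_1b=-a_0b$; (ii) $a_0b=-b_0a$; $b_1b'=b'_1b$; $b_0b'=-b'_0b+\partial(b'_1b)$; (iii) $a_0u_0v-u_0a_0v=(a_0u)_0v$; $u_0v_0w-v_0u_0w=(u_0v)_0w$; $u_0v_1w-v_1u_0w=(u_0v)_1w$. Furthermore, if $C=A\oplus B$ is a $1$-truncated conformal algebra, then the quotient nonassociative algebra $\mathcal L(A\oplus B)=L(A\oplus B)/\hat\partial L(A)$, with the grading induced by $\deg(a\otimes t^n)=-n-1$ for $a\in A$ and $\deg(b\otimes t^n)=-n$ for $b\in B$ ($n\in\mathbb{Z}$), is a $\mathbb{Z}$-graded Lie algebra.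
   Context: All vector spaces are over $\mathbb{C}$. A $1$-truncated conformal algebra is a graded vector space $C=C_0\oplus C_1$ with a linear map $\partial:C_0\to C_1$ and bilinear operations $(u,v)\mapsto u_iv$, $i=0,1$, of degree $-i-1$ on $C$ (i.e. $u_iv\in C_{p+q-i-1}$ for $u\in C_p$, $v\in C_q$, where $C_n=0$ for $n\ne0,1$) such that: (Derivation) for $a\in C_0$, $u\in C_1$: $(\partial a)_0=0$, $(\partial a)_1=-a_0$, $\partial(u_0a)=u_0\partial a$; (Commutativity) for $a\in C_0$, $u,v\in C_1$: $u_0a=-a_0u$, $u_0v=-v_0u+\partial(v_1u)$, $u_1v=v_1u$; (Associativity) for $\alpha,\beta,\gamma\in C_0\oplus C_1$ and $i=0,1$: $\alpha_0\beta_i\gamma=\beta_i\alpha_0\gamma+(\alpha_0\beta)_i\gamma$. $L(A\oplus B)=(A\oplus B)\otimes\mathbb{C}[t,t^{-1}]$, $L(A)=A\otimes\mathbb{C}[t,t^{-1}]$, and $\hat\partial=\partial\otimes1+1\otimes d/dt:L(A)\to L(A\oplus B)$, i.e. $\hat\partial(a\otimes t^n)=\partial a\otimes t^n+na\otimes t^{n-1}$. The product on $L(A\oplus B)$ is the bilinear one given by $[a\otimes t^m,a'\otimes t^n]=0$, $[a\otimes t^m,b\otimes t^n]=a_0b\otimes t^{m+n}$, $[b\otimes t^n,a\otimes t^m]=b_0a\otimes t^{m+n}$, $[b\otimes t^m,b'\otimes t^n]=b_0b'\otimes t^{m+n}+m(b_1b')\otimes t^{m+n-1}$ for $a,a'\in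 A$, $b,b'\in B$, $m,n\in\mathbb{Z}$. When the relations (i) hold, $\hat\partial L(A)$ is a two-sided ideal, so the quotient is a nonassociative algebra. *)

theory Defs
  imports
    "HOL-Analysis.Product_Vector"
    "HOL-Library.Poly_Mapping"
    "HOL-Algebra.QuotRing"
    "HOL-Algebra.Module"
    "HOL-Algebra.Algebraic_Closure_Type"
begin

section \<open>Truncated conformal algebras\<close>

definition bilinear_map ::
  "(complex \<Rightarrow> 'a::ab_group_add \<Rightarrow> 'a) \<Rightarrow> (complex \<Rightarrow> 'b::ab_group_add \<Rightarrow> 'b) \<Rightarrow>
   (complex \<Rightarrow> 'c::ab_group_add \<Rightarrow> 'c) \<Rightarrow> ('a \<Rightarrow> 'b \<Rightarrow> 'c) \<Rightarrow> bool"
  where "bilinear_map s1 s2 s3 f \<longleftrightarrow>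
    (\<forall>x. Vector_Spaces.linear s2 s3 (\<lambda>y. f x y)) \<and>
    (\<forall>y. Vector_Spaces.linear s1 s3 (\<lambda>x. f x y))"

text \<open>The graded space \<open>C\<^sub>0 \<oplus> C\<^sub>1\<close> is the product type, with \<open>a \<in> C\<^sub>0\<close> embedded
  as \<open>(a, 0)\<close> and \<open>u \<in> C\<^sub>1\<close> as \<open>(0, u)\<close>.\<close>

definition homogeneous :: "int \<Rightarrow> ('a::zero \<times> 'b::zero) set"
  where "homogeneous p =
    (if p = 0 then UNIV \<times> {0} else if p = 1 then {0} \<times> UNIV else {0})"

text \<open>\<open>pr i x y\<close> is \<open>x\<^sub>i y\<close>; only \<open>i = 0, 1\<close> are used. The \<open>fst\<close> in front of \<open>D\<close> reads
  an element of degree \<open>0\<close> of the product type as an element of \<open>C\<^sub>0\<close>.\<close>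

locale one_truncated_conformal_algebra =
  fixes s0 :: "complex \<Rightarrow> 'a::ab_group_add \<Rightarrow> 'a"
    and s1 :: "complex \<Rightarrow> 'b::ab_group_add \<Rightarrow> 'b"
    and D :: "'a \<Rightarrow> 'b"
    and pr :: "nat \<Rightarrow> 'a \<times> 'b \<Rightarrow> 'a \<times> 'b \<Rightarrow> 'a \<times> 'b"
  assumes vector_space_0: "vector_space s0"
    and vector_space_1: "vector_space s1"
    and linear_D: "Vector_Spaces.linear s0 s1 D"
    and bilinear: "i \<in> {0, 1} \<Longrightarrow>
      bilinear_map (module_prod.scale s0 s1) (module_prod.scale s0 s1) (module_prod.scale s0 s1) (pr i)"
    and degree: "\<lbrakk>i \<in> {0, 1}; u \<in> homogeneous p; v \<in> homogeneous q\<rbrakk> \<Longrightarrow>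
      pr i u v \<in> homogeneous (p + q - int i - 1)"
    and derivation_0: "pr 0 (0, D a) x = 0"
    and derivation_1: "pr 1 (0, D a) x = - pr 0 (a, 0) x"
    and derivation_D: "(0, D (fst (pr 0 (0, u1) (a, 0)))) = pr 0 (0, u1) (0, D a)"
    and commutativity_10: "pr 0 (0, u1) (a, 0) = - pr 0 (a, 0) (0, u1)"
    and commutativity_11:
      "pr 0 (0, u1) (0, v1) = - pr 0 (0, v1) (0, u1) + (0, D (fst (pr 1 (0, v1) (0, u1))))"
    and commutativity_1: "pr 1 (0, u1) (0, v1) = pr 1 (0, v1) (0, u1)"
    and associativity: "i \<in> {0, 1} \<Longrightarrow>
      pr 0 x (pr i y z) = pr i y (pr 0 x z) + pr i (pr 0 x y) z"

definition total_prod ::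
  "('a \<Rightarrow> 'b \<Rightarrow> 'a) \<Rightarrow> ('b \<Rightarrow> 'a \<Rightarrow> 'a) \<Rightarrow> ('b \<Rightarrow> 'b \<Rightarrow> 'b) \<Rightarrow> ('b \<Rightarrow> 'b \<Rightarrow> 'a) \<Rightarrow>
   nat \<Rightarrow> 'a::ab_group_add \<times> 'b::ab_group_add \<Rightarrow> 'a \<times> 'b \<Rightarrow> 'a \<times> 'b"
  where "total_prod ab ba bb0 bb1 i = (\<lambda>(a, b) (a', b').
    if i = 0 then (ab a b' + ba b a', bb0 b b')
    else if i = 1 then (bb1 b b', 0)
    else 0)"

section \<open>The loop algebra and its quotient\<close>

text \<open>\<open>V \<otimes> \<complex>[t, t\<inverse>]\<close> is modelled by the finitely supported functions \<open>int \<Rightarrow>\<^sub>0 V\<close>, where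
  \<open>v \<otimes> t\<^sup>n\<close> is \<open>Poly_Mapping.single n v\<close>.\<close>

definition loop_scale ::
  "(complex \<Rightarrow> 'v::ab_group_add \<Rightarrow> 'v) \<Rightarrow> complex \<Rightarrow> (int \<Rightarrow>\<^sub>0 'v) \<Rightarrow> (int \<Rightarrow>\<^sub>0 'v)"
  where "loop_scale s c = Poly_Mapping.map (s c)"

definition loop_D ::
  "(complex \<Rightarrow> 'a::ab_group_add \<Rightarrow> 'a) \<Rightarrow> ('a \<Rightarrow> 'b::ab_group_add) \<Rightarrow>
   (int \<Rightarrow>\<^sub>0 'a) \<Rightarrow> (int \<Rightarrow>\<^sub>0 'a \<times> 'b)"
  where "loop_D sA D f = (\<Sum>n\<in>Poly_Mapping.keys f.
    Poly_Mapping.single n (0, D (Poly_Mapping.lookup f n)) +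
    Poly_Mapping.single (n - 1) (sA (of_int n) (Poly_Mapping.lookup f n), 0))"

text \<open>\<open>monomial_bracket \<dots> x m y n\<close> is the product of \<open>x \<otimes> t\<^sup>m\<close> and \<open>y \<otimes> t\<^sup>n\<close>, and \<open>loop_bracket\<close> is its
  bilinear extension.\<close>

definition monomial_bracket ::
  "(complex \<Rightarrow> 'a::ab_group_add \<Rightarrow> 'a) \<Rightarrow>
   ('a \<Rightarrow> 'b::ab_group_add \<Rightarrow> 'a) \<Rightarrow> ('b \<Rightarrow> 'a \<Rightarrow> 'a) \<Rightarrow> ('b \<Rightarrow> 'b \<Rightarrow> 'b) \<Rightarrow> ('b \<Rightarrow> 'b \<Rightarrow> 'a) \<Rightarrow>
   'a \<times> 'b \<Rightarrow> int \<Rightarrow> 'a \<times> 'b \<Rightarrow> int \<Rightarrow> (int \<Rightarrow>\<^sub>0 'a \<times> 'b)"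
  where "monomial_bracket sA ab ba bb0 bb1 x m y n = (case (x, y) of ((a, b), (a', b')) \<Rightarrow>
    Poly_Mapping.single (m + n) (ab a b', 0) +
    Poly_Mapping.single (m + n) (ba b a', 0) +
    (Poly_Mapping.single (m + n) (0, bb0 b b') +
     Poly_Mapping.single (m + n - 1) (sA (of_int m) (bb1 b b'), 0)))"

definition loop_bracket ::
  "(complex \<Rightarrow> 'a::ab_group_add \<Rightarrow> 'a) \<Rightarrow>
   ('a \<Rightarrow> 'b::ab_group_add \<Rightarrow> 'a) \<Rightarrow> ('b \<Rightarrow> 'a \<Rightarrow> 'a) \<Rightarrow> ('b \<Rightarrow> 'b \<Rightarrow> 'b) \<Rightarrow> ('b \<Rightarrow> 'b \<Rightarrow> 'a) \<Rightarrow>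
   (int \<Rightarrow>\<^sub>0 'a \<times> 'b) \<Rightarrow> (int \<Rightarrow>\<^sub>0 'a \<times> 'b) \<Rightarrow> (int \<Rightarrow>\<^sub>0 'a \<times> 'b)"
  where "loop_bracket sA ab ba bb0 bb1 x y =
    (\<Sum>m\<in>Poly_Mapping.keys x. \<Sum>n\<in>Poly_Mapping.keys y.
      monomial_bracket sA ab ba bb0 bb1 (Poly_Mapping.lookup x m) m (Poly_Mapping.lookup y n) n)"

text \<open>Nonassociative algebras are records of type \<open>module\<close>, with the product in the field \<open>mult\<close>.
  They have no unit: the value of the field \<open>one\<close> is irrelevant.\<close>

definition loop_algebra ::
  "(complex \<Rightarrow> 'a::ab_group_add \<Rightarrow> 'a) \<Rightarrow> (complex \<Rightarrow> 'b::ab_group_add \<Rightarrow> 'b) \<Rightarrow>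
   ('a \<Rightarrow> 'b \<Rightarrow> 'a) \<Rightarrow> ('b \<Rightarrow> 'a \<Rightarrow> 'a) \<Rightarrow> ('b \<Rightarrow> 'b \<Rightarrow> 'b) \<Rightarrow> ('b \<Rightarrow> 'b \<Rightarrow> 'a) \<Rightarrow>
   (complex, int \<Rightarrow>\<^sub>0 'a \<times> 'b) module"
  where "loop_algebra sA sB ab ba bb0 bb1 =
    \<lparr>carrier = UNIV, monoid.mult = loop_bracket sA ab ba bb0 bb1, one = 0, zero = 0, add = (+),
     module.smult = loop_scale (module_prod.scale sA sB)\<rparr>"

definition quotient_algebra :: "('r, 'm) module \<Rightarrow> 'm set \<Rightarrow> ('r, 'm set) module"
  where "quotient_algebra L I =
    ring.extend (L Quot I)
      (module.fields (\<lambda>c S. \<Union>x\<in>S. I +>\<^bsub>L\<^esub> (c \<odot>\<^bsub>L\<^esub> x)))"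

definition loop_ideal ::
  "(complex \<Rightarrow> 'a::ab_group_add \<Rightarrow> 'a) \<Rightarrow> ('a \<Rightarrow> 'b::ab_group_add) \<Rightarrow> (int \<Rightarrow>\<^sub>0 'a \<times> 'b) set"
  where "loop_ideal sA D = range (loop_D sA D)"

definition quotient_loop_algebra ::
  "(complex \<Rightarrow> 'a::ab_group_add \<Rightarrow> 'a) \<Rightarrow> (complex \<Rightarrow> 'b::ab_group_add \<Rightarrow> 'b) \<Rightarrow> ('a \<Rightarrow> 'b) \<Rightarrow>
   ('a \<Rightarrow> 'b \<Rightarrow> 'a) \<Rightarrow> ('b \<Rightarrow> 'a \<Rightarrow> 'a) \<Rightarrow> ('b \<Rightarrow> 'b \<Rightarrow> 'b) \<Rightarrow> ('b \<Rightarrow> 'b \<Rightarrow> 'a) \<Rightarrow>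
   (complex, (int \<Rightarrow>\<^sub>0 'a \<times> 'b) set) module"
  where "quotient_loop_algebra sA sB D ab ba bb0 bb1 =
    quotient_algebra (loop_algebra sA sB ab ba bb0 bb1) (loop_ideal sA D)"

definition loop_degree ::
  "(complex \<Rightarrow> 'a::ab_group_add \<Rightarrow> 'a) \<Rightarrow> (complex \<Rightarrow> 'b::ab_group_add \<Rightarrow> 'b) \<Rightarrow>
   int \<Rightarrow> (int \<Rightarrow>\<^sub>0 'a \<times> 'b) set"
  where "loop_degree sA sB d = module.span (loop_scale (module_prod.scale sA sB))
    ({Poly_Mapping.single n (a, 0) | n a. - n - 1 = d} \<union>
     {Poly_Mapping.single n (0, b) | n b. - n = d})"

definition quotient_degree ::
  "(complex \<Rightarrow> 'a::ab_group_add \<Rightarrow> 'a) \<Rightarrow> (complex \<Rightarrow> 'b::ab_group_add \<Rightarrow> 'b) \<Rightarrow> ('a \<Rightarrow> 'b) \<Rightarrow>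
   ('a \<Rightarrow> 'b \<Rightarrow> 'a) \<Rightarrow> ('b \<Rightarrow> 'a \<Rightarrow> 'a) \<Rightarrow> ('b \<Rightarrow> 'b \<Rightarrow> 'b) \<Rightarrow> ('b \<Rightarrow> 'b \<Rightarrow> 'a) \<Rightarrow>
   int \<Rightarrow> (int \<Rightarrow>\<^sub>0 'a \<times> 'b) set set"
  where "quotient_degree sA sB D ab ba bb0 bb1 d =
    (\<lambda>x. loop_ideal sA D +>\<^bsub>loop_algebra sA sB ab ba bb0 bb1\<^esub> x) ` loop_degree sA sB d"

section \<open>Graded Lie algebras\<close>

locale nonassociative_algebra = Module.module R L for R (structure) and L (structure) +
  assumes mult_closed:
      "\<lbrakk>x \<in> carrier L; y \<in> carrier L\<rbrakk> \<Longrightarrow> x \<otimes>\<^bsub>L\<^esub> y \<in> carrier L"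
    and mult_l_distr: "\<lbrakk>x \<in> carrier L; y \<in> carrier L; z \<in> carrier L\<rbrakk> \<Longrightarrow>
      (x \<oplus>\<^bsub>L\<^esub> y) \<otimes>\<^bsub>L\<^esub> z = x \<otimes>\<^bsub>L\<^esub> z \<oplus>\<^bsub>L\<^esub> y \<otimes>\<^bsub>L\<^esub> z"
    and mult_r_distr: "\<lbrakk>x \<in> carrier L; y \<in> carrier L; z \<in> carrier L\<rbrakk> \<Longrightarrow>
      x \<otimes>\<^bsub>L\<^esub> (y \<oplus>\<^bsub>L\<^esub> z) = x \<otimes>\<^bsub>L\<^esub> y \<oplus>\<^bsub>L\<^esub> x \<otimes>\<^bsub>L\<^esub> z"
    and mult_smult_l: "\<lbrakk>c \<in> carrier R; x \<in> carrier L; y \<in> carrier L\<rbrakk> \<Longrightarrow>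
      (c \<odot>\<^bsub>L\<^esub> x) \<otimes>\<^bsub>L\<^esub> y = c \<odot>\<^bsub>L\<^esub> (x \<otimes>\<^bsub>L\<^esub> y)"
    and mult_smult_r: "\<lbrakk>c \<in> carrier R; x \<in> carrier L; y \<in> carrier L\<rbrakk> \<Longrightarrow>
      x \<otimes>\<^bsub>L\<^esub> (c \<odot>\<^bsub>L\<^esub> y) = c \<odot>\<^bsub>L\<^esub> (x \<otimes>\<^bsub>L\<^esub> y)"

locale lie_algebra = nonassociative_algebra R L + R?: Ring.field R
  for R (structure) and L (structure) +
  assumes alternating: "x \<in> carrier L \<Longrightarrow> x \<otimes>\<^bsub>L\<^esub> x = \<zero>\<^bsub>L\<^esub>"
    and jacobi: "\<lbrakk>x \<in> carrier L; y \<in> carrier L; z \<in> carrier L\<rbrakk> \<Longrightarrow>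
      x \<otimes>\<^bsub>L\<^esub> (y \<otimes>\<^bsub>L\<^esub> z) \<oplus>\<^bsub>L\<^esub> y \<otimes>\<^bsub>L\<^esub> (z \<otimes>\<^bsub>L\<^esub> x) \<oplus>\<^bsub>L\<^esub> z \<otimes>\<^bsub>L\<^esub> (x \<otimes>\<^bsub>L\<^esub> y) = \<zero>\<^bsub>L\<^esub>"

text \<open>The assumption \<open>direct_sum\<close> says that \<open>L\<close> is the internal direct sum of the subspaces
  \<open>G n\<close>, each element having a unique family of homogeneous components.\<close>

locale int_graded_lie_algebra = lie_algebra R L for R (structure) and L (structure) +
  fixes G :: "int \<Rightarrow> 'c set"
  assumes component: "submodule (G n) R L"
    and direct_sum: "x \<in> carrier L \<Longrightarrow>
      \<exists>!f. (\<forall>n. f n \<in> G n) \<and> finite {n. f n \<noteq> \<zero>\<^bsub>L\<^esub>} \<and>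
        x = (\<Oplus>\<^bsub>L\<^esub>n\<in>{n. f n \<noteq> \<zero>\<^bsub>L\<^esub>}. f n)"
    and graded_mult: "\<lbrakk>x \<in> G m; y \<in> G n\<rbrakk> \<Longrightarrow> x \<otimes>\<^bsub>L\<^esub> y \<in> G (m + n)"

end

theory Submission
  imports Defs
begin

text \<open>The equivalence is a matter of reading axioms componentwise. From left to right the axioms are
  evaluated at elements of \<open>A\<close> or \<open>B\<close>. From right to left the point is that the relations
  contain the associativity axiom for one ordering only of one factor from \<open>A\<close> and two from
  \<open>B\<close>, and that the other orderings follow from \<open>a\<^sub>0b = -b\<^sub>0a\<close>; products with two or more factors from \<open>A\<close> vanish by degree.

  For the second part, the bracket on the loop space \<open>L(A \<oplus> B)\<close> satisfies the Leibniz identity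
  \<open>[x, [y, z]] = [y, [x, z]] + [[x, y], z]\<close> exactly (\<open>leibniz\<close>). It is not skew-symmetric, but
  \<open>[x, y] + [y, x]\<close> is always in the image \<open>I\<close> of the derivation \<open>D \<otimes> 1 + 1 \<otimes> d/dt\<close>: for
  \<open>b \<otimes> t\<^sup>m\<close> and \<open>b' \<otimes> t\<^sup>n\<close> it is the image of \<open>b\<^sub>1b' \<otimes> t\<^sup>m\<^sup>+\<^sup>n\<close> (\<open>br_skew_in_ideal\<close>), and
  halving gives \<open>[x, x] \<in> I\<close>. Moreover \<open>I\<close> is a two-sided ideal (\<open>loop_D_br\<close>, \<open>br_loop_D_in_ideal\<close>).

  What remains is general algebra: if a bilinear bracket satisfies the Leibniz identity and \<open>I\<close> is an
  ideal that contains all squares, then the quotient by \<open>I\<close> is a Lie algebra (\<open>lie_algebra_quot\<close>), since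
  modulo \<open>I\<close> the Leibniz and the Jacobi identity are the same. If in addition the bracket respects
  a grading and \<open>I\<close> is homogeneous, then the quotient inherits the grading
  (\<open>int_graded_lie_algebra_quot\<close>). The ideal here is homogeneous because the derivation has degree 0
  when \<open>a \<otimes> t\<^sup>n\<close>, as an element of \<open>L(A)\<close>, is given degree \<open>-n\<close>.\<close>

section \<open>Lie algebras as quotients of Leibniz algebras\<close>

text \<open>Left multiplications are derivations of the bracket, but the bracket need not be
  skew-symmetric: the loop bracket satisfies the Leibniz identity on the nose, and its failure to be
  alternating is absorbed by the ideal.\<close>

locale leibniz_algebra_ideal = vector_space s
  for s :: "'k::field \<Rightarrow> 'v::ab_group_add \<Rightarrow> 'v" +
  fixes br :: "'v \<Rightarrow> 'v \<Rightarrow> 'v"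
    and I :: "'v set"
  assumes br_add_left: "br (x + y) z = br x z + br y z"
    and br_add_right: "br x (y + z) = br x y + br x z"
    and br_scale_left: "br (s c x) y = s c (br x y)"
    and br_scale_right: "br x (s c y) = s c (br x y)"
    and leibniz: "br x (br y z) = br y (br x z) + br (br x y) z"
    and subspace_I: "subspace I"
    and ideal_left: "i \<in> I \<Longrightarrow> br x i \<in> I"
    and ideal_right: "i \<in> I \<Longrightarrow> br i x \<in> I"
    and square_in_ideal: "br x x \<in> I"
begin

definition alg :: "('k, 'v) module" where
  "alg = \<lparr>carrier = UNIV, monoid.mult = br, one = 0, zero = 0, add = (+), module.smult = s\<rparr>"

abbreviation quot :: "('k, 'v set) module" where
  "quot \<equiv> quotient_algebra alg I"

definition coset :: "'v \<Rightarrow> 'v set" where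
  "coset x = I +>\<^bsub>alg\<^esub> x"

lemma in_coset_iff: "y \<in> coset x \<longleftrightarrow> y - x \<in> I"
proof -
  have "coset x = (\<lambda>i. i + x) ` I"
    by (auto simp: coset_def alg_def a_r_coset_def r_coset_def)
  then show ?thesis
    by (auto simp: image_iff intro: bexI[of _ "y - x"])
qed

lemma zero_I: "0 \<in> I" and add_I: "\<lbrakk>x \<in> I; y \<in> I\<rbrakk> \<Longrightarrow> x + y \<in> I"
  and diff_I: "\<lbrakk>x \<in> I; y \<in> I\<rbrakk> \<Longrightarrow> x - y \<in> I" and scale_I: "x \<in> I \<Longrightarrow> s c x \<in> I"
  using subspace_I by (simp_all add: subspace_0 subspace_add subspace_diff subspace_scale)

lemma coset_eq_iff: "coset x = coset y \<longleftrightarrow> x - y \<in> I"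
proof
  assume "coset x = coset y"
  then show "x - y \<in> I"
    using in_coset_iff[of x x] by (simp add: in_coset_iff zero_I)
next
  assume xy: "x - y \<in> I"
  show "coset x = coset y"
  proof (rule Set.set_eqI)
    fix z
    have "z - y = (z - x) + (x - y)" "z - x = (z - y) - (x - y)"
      by simp_all
    then show "z \<in> coset x \<longleftrightarrow> z \<in> coset y"
      unfolding in_coset_iff using xy add_I diff_I by metis
  qed
qed

lemma coset_self: "x \<in> coset x"
  by (simp add: in_coset_iff zero_I)

lemma coset_0: "coset 0 = I"
  by (auto simp: in_coset_iff)

text \<open>The multiplication and the scalar action of the quotient are defined as unions over all
  representatives; such a union collapses as soon as its members do not depend on the
  representative.\<close>

lemma Union_coset:
  assumes "\<And>y. y \<in> coset x \<Longrightarrow> F y = F x"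
  shows "(\<Union>y\<in>coset x. F y) = F x"
  using assms coset_self by blast

lemma br_diff_left: "br (x - y) z = br x z - br y z"
  and br_diff_right: "br z (x - y) = br z x - br z y"
  using br_add_left[of "x - y" y z] br_add_right[of z "x - y" y] by simp_all

lemma carrier_quot: "carrier quot = range coset"
  by (auto simp: quotient_algebra_def ring.defs module.defs FactRing_def A_RCOSETS_def' coset_def alg_def)

lemma zero_quot: "\<zero>\<^bsub>quot\<^esub> = coset 0"
  by (simp add: quotient_algebra_def ring.defs module.defs FactRing_def coset_0)

lemma add_quot: "coset x \<oplus>\<^bsub>quot\<^esub> coset y = coset (x + y)"
proof -
  have "coset x \<oplus>\<^bsub>quot\<^esub> coset y = (\<Union>u\<in>coset x. \<Union>v\<in>coset y. {u + v})"
    by (simp add: quotient_algebra_def ring.defs module.defs FactRing_def set_add_def' alg_def)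
  also have "\<dots> = coset (x + y)"
  proof (intro Set.set_eqI iffI)
    fix z assume "z \<in> (\<Union>u\<in>coset x. \<Union>v\<in>coset y. {u + v})"
    then obtain u v where "u - x \<in> I" "v - y \<in> I" "z = u + v"
      by (auto simp: in_coset_iff)
    then show "z \<in> coset (x + y)"
      using add_I[of "u - x" "v - y"] by (simp add: in_coset_iff algebra_simps)
  next
    fix z assume z: "z \<in> coset (x + y)"
    then have "z - y \<in> coset x"
      by (simp add: in_coset_iff algebra_simps)
    moreover have "z = (z - y) + y"
      by simp
    ultimately show "z \<in> (\<Union>u\<in>coset x. \<Union>v\<in>coset y. {u + v})"
      using coset_self[of y] by blast
  qed
  finally show ?thesis .
qed

lemma mult_quot: "coset x \<otimes>\<^bsub>quot\<^esub> coset y = coset (br x y)"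
proof -
  have "coset x \<otimes>\<^bsub>quot\<^esub> coset y = (\<Union>u\<in>coset x. \<Union>v\<in>coset y. coset (br u v))"
    by (simp add: quotient_algebra_def ring.defs module.defs FactRing_def rcoset_mult_def
        coset_def alg_def)
  also have "\<dots> = (\<Union>u\<in>coset x. coset (br u y))"
    by (intro SUP_cong refl Union_coset)
      (simp add: in_coset_iff coset_eq_iff ideal_left flip: br_diff_right)
  also have "\<dots> = coset (br x y)"
    by (intro Union_coset) (simp add: in_coset_iff coset_eq_iff ideal_right flip: br_diff_left)
  finally show ?thesis .
qed

lemma smult_quot: "c \<odot>\<^bsub>quot\<^esub> coset x = coset (s c x)"
proof -
  have "c \<odot>\<^bsub>quot\<^esub> coset x = (\<Union>u\<in>coset x. coset (s c u))"
    by (simp add: quotient_algebra_def ring.defs module.defs coset_def alg_def)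
  also have "\<dots> = coset (s c x)"
    by (intro Union_coset)
      (simp add: in_coset_iff coset_eq_iff scale_I flip: scale_right_diff_distrib)
  finally show ?thesis .
qed

lemmas quot_simps = carrier_quot zero_quot add_quot mult_quot smult_quot

text \<open>Polarization of \<open>square_in_ideal\<close>.\<close>

lemma skew_in_ideal: "br x y + br y x \<in> I"
proof -
  have "br x y + br y x = br (x + y) (x + y) - br x x - br y y"
    by (simp add: br_add_left br_add_right)
  then show ?thesis
    by (simp add: diff_I square_in_ideal)
qed

lemma abelian_group_quot: "abelian_group quot"
proof (rule abelian_groupI)
  fix A assume "A \<in> carrier quot"
  then obtain x where "A = coset x" by (auto simp: carrier_quot)
  then show "\<exists>B\<in>carrier quot. B \<oplus>\<^bsub>quot\<^esub> A = \<zero>\<^bsub>quot\<^esub>"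
    by (intro bexI[of _ "coset (- x)"]) (simp_all add: quot_simps)
qed (auto simp: quot_simps add_ac)

lemma module_quot: "Module.module (ring_of_type_algebra :: 'k ring) quot"
  by (rule moduleI[OF cring_from_type_algebra abelian_group_quot])
    (auto simp: quot_simps ring_of_type_algebra_def scale_left_distrib scale_right_distrib)

lemma nonassociative_algebra_quot:
  "nonassociative_algebra (ring_of_type_algebra :: 'k ring) quot"
  by (intro nonassociative_algebra.intro module_quot nonassociative_algebra_axioms.intro)
    (auto simp: quot_simps br_add_left br_add_right br_scale_left br_scale_right)

text \<open>Expanding the first summand by the Leibniz identity pairs every double product with its
  mirror image, so that the cyclic sum consists of two values of the symmetrized bracket, one of
  them multiplied by \<open>y\<close>.\<close>

lemma jacobi_in_ideal: "br x (br y z) + br y (br z x) + br z (br x y) \<in> I"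
proof -
  have "br x (br y z) + br y (br z x) + br z (br x y) =
      br y (br x z + br z x) + (br (br x y) z + br z (br x y))"
    by (simp add: leibniz[of x y z] br_add_right algebra_simps)
  then show ?thesis
    by (simp only: add_I ideal_left skew_in_ideal)
qed

lemma lie_algebra_quot: "lie_algebra (ring_of_type_algebra :: 'k ring) quot"
proof (intro lie_algebra.intro nonassociative_algebra_quot field_from_type_algebra
    lie_algebra_axioms.intro)
  fix A assume "A \<in> carrier quot"
  then obtain x where "A = coset x" by (auto simp: carrier_quot)
  then show "A \<otimes>\<^bsub>quot\<^esub> A = \<zero>\<^bsub>quot\<^esub>"
    by (simp add: quot_simps coset_eq_iff square_in_ideal)
next
  fix A B C assume "A \<in> carrier quot" "B \<in> carrier quot" "C \<in> carrier quot"
  then obtain x y z where "A = coset x" "B = coset y" "C = coset z"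
    by (auto simp: carrier_quot)
  then show "A \<otimes>\<^bsub>quot\<^esub> (B \<otimes>\<^bsub>quot\<^esub> C) \<oplus>\<^bsub>quot\<^esub> B \<otimes>\<^bsub>quot\<^esub> (C \<otimes>\<^bsub>quot\<^esub> A) \<oplus>\<^bsub>quot\<^esub>
      C \<otimes>\<^bsub>quot\<^esub> (A \<otimes>\<^bsub>quot\<^esub> B) = \<zero>\<^bsub>quot\<^esub>"
    by (simp add: quot_simps coset_eq_iff jacobi_in_ideal)
qed

lemma finsum_quot:
  assumes "finite T"
  shows "(\<Oplus>\<^bsub>quot\<^esub>n\<in>T. coset (g n)) = coset (\<Sum>n\<in>T. g n)"
proof -
  interpret Q: abelian_group quot by (rule abelian_group_quot)
  show ?thesis
    using assms by (induction T) (simp_all add: quot_simps Pi_def)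
qed

end

text \<open>The grading is given together with its projections \<open>P n\<close>; in terms of these, \<open>P_I\<close> says
  that the ideal is homogeneous.\<close>

locale graded_leibniz_algebra_ideal = leibniz_algebra_ideal s br I
  for s :: "'k::field \<Rightarrow> 'v::ab_group_add \<Rightarrow> 'v" and br I +
  fixes G :: "int \<Rightarrow> 'v set"
    and P :: "int \<Rightarrow> 'v \<Rightarrow> 'v"
  assumes subspace_G: "subspace (G n)"
    and br_G: "\<lbrakk>x \<in> G m; y \<in> G n\<rbrakk> \<Longrightarrow> br x y \<in> G (m + n)"
    and P_add: "P n (x + y) = P n x + P n y"
    and P_in_G: "P n x \<in> G n"
    and P_G: "x \<in> G m \<Longrightarrow> P n x = (if n = m then x else 0)"
    and P_I: "x \<in> I \<Longrightarrow> P n x \<in> I"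
    and decomposition: "\<exists>S. finite S \<and> (\<forall>n. n \<notin> S \<longrightarrow> P n x = 0) \<and> x = (\<Sum>n\<in>S. P n x)"
begin

sublocale P: additive "P n" for n
  by unfold_locales (rule P_add)

abbreviation quot_G :: "int \<Rightarrow> 'v set set" where
  "quot_G n \<equiv> coset ` G n"

lemma submodule_quot_G: "submodule (quot_G n) (ring_of_type_algebra :: 'k ring) quot"
proof -
  interpret M: Module.module "ring_of_type_algebra :: 'k ring" quot by (rule module_quot)
  have neg: "\<ominus>\<^bsub>quot\<^esub> coset x = coset (- x)" for x
    by (rule M.minus_equality) (simp_all add: quot_simps)
  show ?thesis
    by (rule M.submoduleI)
      (auto simp: quot_simps neg subspace_0[OF subspace_G] subspace_neg[OF subspace_G]
        subspace_add[OF subspace_G] subspace_scale[OF subspace_G])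
qed

text \<open>The components of \<open>coset x\<close> are the cosets of the components of \<open>x\<close>. Their support may
  shrink in the quotient, but the components lost lie in the ideal. For uniqueness, any other family
  lifts to homogeneous elements \<open>g n\<close> with \<open>x - (\<Sum>n. g n) \<in> I\<close>, and projecting this element of
  the homogeneous ideal shows \<open>P m x - g m \<in> I\<close>.\<close>

lemma direct_sum_quot:
  "\<exists>!f. (\<forall>n. f n \<in> quot_G n) \<and> finite {n. f n \<noteq> \<zero>\<^bsub>quot\<^esub>} \<and>
    coset x = (\<Oplus>\<^bsub>quot\<^esub>n\<in>{n. f n \<noteq> \<zero>\<^bsub>quot\<^esub>}. f n)"
proof (rule ex1I[of _ "\<lambda>n. coset (P n x)"], intro conjI allI)
  let ?T = "{n. coset (P n x) \<noteq> \<zero>\<^bsub>quot\<^esub>}"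
  obtain S where S: "finite S" "\<And>n. n \<notin> S \<Longrightarrow> P n x = 0" "x = (\<Sum>n\<in>S. P n x)"
    using decomposition by blast
  have sub: "?T \<subseteq> S"
    using S(2) by (auto simp: zero_quot)
  show fin: "finite ?T"
    using sub S(1) by (rule finite_subset)
  have "(\<Sum>n\<in>S - ?T. P n x) \<in> I"
    by (intro subspace_sum subspace_I) (simp add: zero_quot coset_eq_iff)
  moreover have "x - (\<Sum>n\<in>?T. P n x) = (\<Sum>n\<in>S - ?T. P n x)"
    using S(1,3) sub by (simp add: sum_diff)
  ultimately have "coset x = coset (\<Sum>n\<in>?T. P n x)"
    by (simp add: coset_eq_iff)
  then show "coset x = (\<Oplus>\<^bsub>quot\<^esub>n\<in>?T. coset (P n x))"
    by (simp add: finsum_quot fin)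
next
  fix n show "coset (P n x) \<in> quot_G n"
    by (simp add: P_in_G)
next
  fix f :: "int \<Rightarrow> 'v set"
  let ?T = "{n. f n \<noteq> \<zero>\<^bsub>quot\<^esub>}"
  assume f: "(\<forall>n. f n \<in> quot_G n) \<and> finite ?T \<and> coset x = (\<Oplus>\<^bsub>quot\<^esub>n\<in>?T. f n)"
  then have "\<forall>n. \<exists>y. y \<in> G n \<and> f n = coset y"
    by blast
  then obtain g where g: "\<And>n. g n \<in> G n" "\<And>n. f n = coset (g n)"
    by metis
  have "coset x = coset (\<Sum>n\<in>?T. g n)"
    using f by (simp add: g(2) finsum_quot)
  then have diff: "x - (\<Sum>n\<in>?T. g n) \<in> I"
    by (simp add: coset_eq_iff)
  show "f = (\<lambda>n. coset (P n x))"
  proof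
    fix m
    have "P m (\<Sum>n\<in>?T. g n) = (\<Sum>n\<in>?T. if m = n then g n else 0)"
      by (simp add: P.sum P_G[OF g(1)])
    also have "\<dots> = (if m \<in> ?T then g m else 0)"
      using f by (intro sum.delta') simp
    finally have "P m x - (if m \<in> ?T then g m else 0) \<in> I"
      using P_I[OF diff, of m] by (simp add: P.diff)
    then have "coset (P m x) = coset (if m \<in> ?T then g m else 0)"
      by (simp only: coset_eq_iff)
    then show "f m = coset (P m x)"
      by (auto simp: zero_quot g(2) split: if_splits)
  qed
qed

lemma int_graded_lie_algebra_quot:
  "int_graded_lie_algebra (ring_of_type_algebra :: 'k ring) quot quot_G"
proof (intro int_graded_lie_algebra.intro lie_algebra_quot int_graded_lie_algebra_axioms.intro
    submodule_quot_G)
  fix A assume "A \<in> carrier quot"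
  then obtain x where x: "A = coset x" by (auto simp: carrier_quot)
  show "\<exists>!f. (\<forall>n. f n \<in> quot_G n) \<and> finite {n. f n \<noteq> \<zero>\<^bsub>quot\<^esub>} \<and>
      A = (\<Oplus>\<^bsub>quot\<^esub>n\<in>{n. f n \<noteq> \<zero>\<^bsub>quot\<^esub>}. f n)"
    unfolding x by (rule direct_sum_quot)
qed (auto simp: mult_quot br_G)

end

section \<open>Bilinear maps and finitely supported functions\<close>

lemma bilinear_mapD:
  assumes "bilinear_map s1 s2 s3 f"
  shows "f (x + x') y = f x y + f x' y" "f x (y + y') = f x y + f x y'"
    and "f (s1 c x) y = s3 c (f x y)" "f x (s2 c y) = s3 c (f x y)"
    and "f 0 y = 0" "f x 0 = 0" "f (- x) y = - f x y" "f x (- y) = - f x y"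
    and "f (x - x') y = f x y - f x' y" "f x (y - y') = f x y - f x y'"
proof -
  have l: "Vector_Spaces.linear s1 s3 (\<lambda>x. f x y)" and r: "Vector_Spaces.linear s2 s3 (\<lambda>y. f x y)"
    for x y
    using assms by (auto simp: bilinear_map_def)
  interpret L: Vector_Spaces.linear s1 s3 "\<lambda>x. f x y" for y by (rule l)
  interpret R: Vector_Spaces.linear s2 s3 "\<lambda>y. f x y" for x by (rule r)
  show "f (x + x') y = f x y + f x' y" "f x (y + y') = f x y + f x y'"
    "f (s1 c x) y = s3 c (f x y)" "f x (s2 c y) = s3 c (f x y)"
    "f 0 y = 0" "f x 0 = 0" "f (- x) y = - f x y" "f x (- y) = - f x y"
    "f (x - x') y = f x y - f x' y" "f x (y - y') = f x y - f x y'"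
    by (simp_all add: L.add R.add L.scale R.scale L.neg R.neg L.diff R.diff)
qed

text \<open>An additive statement about finitely supported functions needs checking on monomials only.\<close>

lemma poly_mapping_single_induct [case_names single add]:
  fixes x :: "'i \<Rightarrow>\<^sub>0 'v::ab_group_add"
  assumes single: "\<And>n v. Q (Poly_Mapping.single n v)"
    and add: "\<And>x y. \<lbrakk>Q x; Q y\<rbrakk> \<Longrightarrow> Q (x + y)"
  shows "Q x"
proof (induction x rule: update_induct)
  case const
  then show ?case using single[of undefined 0] by simp
next
  case (update f n v)
  have "Poly_Mapping.update n v f = f + Poly_Mapping.single n v"
    using update.hyps
    by (intro poly_mapping_eqI) (auto simp: lookup_update lookup_add lookup_single in_keys_iff when_def)
  then show ?case
    using add update.IH single by metis
qed

lemma sum_keys_single: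
  assumes "g n 0 = 0"
  shows "(\<Sum>k\<in>Poly_Mapping.keys (Poly_Mapping.single n v).
    g k (Poly_Mapping.lookup (Poly_Mapping.single n v) k)) = g n v"
  using assms by (cases "v = 0") simp_all

lemma lookup_loop_scale:
  assumes "s c 0 = 0"
  shows "Poly_Mapping.lookup (loop_scale s c x) n = s c (Poly_Mapping.lookup x n)"
  using assms by (simp add: loop_scale_def Poly_Mapping.map.rep_eq when_def)

lemma vector_space_loop_scale:
  assumes "vector_space s"
  shows "vector_space (loop_scale s)"
proof -
  interpret vector_space s by fact
  show ?thesis
    by unfold_locales
      (auto intro!: poly_mapping_eqI simp: lookup_loop_scale lookup_add algebra_simps)
qed

section \<open>The graded space of loops and its bracket\<close>

locale truncated_operations = vector_space_prod sA sB
  for sA :: "complex \<Rightarrow> 'a::ab_group_add \<Rightarrow> 'a"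
    and sB :: "complex \<Rightarrow> 'b::ab_group_add \<Rightarrow> 'b" +
  fixes D :: "'a \<Rightarrow> 'b"
    and ab :: "'a \<Rightarrow> 'b \<Rightarrow> 'a"
    and ba :: "'b \<Rightarrow> 'a \<Rightarrow> 'a"
    and bb0 :: "'b \<Rightarrow> 'b \<Rightarrow> 'b"
    and bb1 :: "'b \<Rightarrow> 'b \<Rightarrow> 'a"
  assumes linear_D: "Vector_Spaces.linear sA sB D"
    and bilinear_ab: "bilinear_map sA sB sA ab"
    and bilinear_ba: "bilinear_map sB sA sA ba"
    and bilinear_bb0: "bilinear_map sB sB sB bb0"
    and bilinear_bb1: "bilinear_map sB sB sA bb1"
begin

sublocale D: Vector_Spaces.linear sA sB D
  by (rule linear_D)

lemmas bilinear_simps =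
  bilinear_mapD[OF bilinear_ab] bilinear_mapD[OF bilinear_ba]
  bilinear_mapD[OF bilinear_bb0] bilinear_mapD[OF bilinear_bb1]

abbreviation loopA :: "int \<Rightarrow> 'a \<Rightarrow> (int \<Rightarrow>\<^sub>0 'a \<times> 'b)" where
  "loopA n a \<equiv> Poly_Mapping.single n (a, 0)"

abbreviation loopB :: "int \<Rightarrow> 'b \<Rightarrow> (int \<Rightarrow>\<^sub>0 'a \<times> 'b)" where
  "loopB n b \<equiv> Poly_Mapping.single n (0, b)"

lemma loopA_0: "loopA n 0 = 0" and loopB_0: "loopB n 0 = 0"
  by (simp_all flip: zero_prod_def)

lemma loopA_add: "loopA n (a + a') = loopA n a + loopA n a'"
  and loopB_add: "loopB n (b + b') = loopB n b + loopB n b'"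
  by (simp_all flip: single_add)

lemma loopB_diff: "loopB n (b - b') = loopB n b - loopB n b'"
  by (simp flip: single_diff)

text \<open>The workhorse for identities between brackets: being additive in every variable, they
  reduce to the generators \<open>a \<otimes> t\<^sup>n\<close> and \<open>b \<otimes> t\<^sup>n\<close>, whose brackets are the rules \<open>br_AA\<close>,
  \<open>br_AB\<close>, \<open>br_BA\<close> and \<open>br_BB\<close> below.\<close>

lemma loop_induct [case_names A B add]:
  assumes A: "\<And>n a. Q (loopA n a)"
    and B: "\<And>n b. Q (loopB n b)"
    and add: "\<And>x y. \<lbrakk>Q x; Q y\<rbrakk> \<Longrightarrow> Q (x + y)"
  shows "Q x"
proof (induction x rule: poly_mapping_single_induct)
  case (single n v)
  have "Poly_Mapping.single n v = loopA n (fst v) + loopB n (snd v)"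
    by (simp flip: single_add)
  then show ?case
    using add[OF A[of n "fst v"] B[of n "snd v"]] by simp
qed (rule add)

abbreviation scl :: "complex \<Rightarrow> (int \<Rightarrow>\<^sub>0 'a \<times> 'b) \<Rightarrow> (int \<Rightarrow>\<^sub>0 'a \<times> 'b)" where
  "scl \<equiv> loop_scale scale"

sublocale loop: vector_space scl
  by (intro vector_space_loop_scale) unfold_locales

lemma scl_A: "scl c (loopA n a) = loopA n (sA c a)"
  and scl_B: "scl c (loopB n b) = loopB n (sB c b)"
  by (simp_all add: loop_scale_def scale_def zero_prod_def)

abbreviation mono :: "'a \<times> 'b \<Rightarrow> int \<Rightarrow> 'a \<times> 'b \<Rightarrow> int \<Rightarrow> (int \<Rightarrow>\<^sub>0 'a \<times> 'b)" where
  "mono \<equiv> monomial_bracket sA ab ba bb0 bb1"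

abbreviation br :: "(int \<Rightarrow>\<^sub>0 'a \<times> 'b) \<Rightarrow> (int \<Rightarrow>\<^sub>0 'a \<times> 'b) \<Rightarrow> (int \<Rightarrow>\<^sub>0 'a \<times> 'b)" where
  "br \<equiv> loop_bracket sA ab ba bb0 bb1"

lemma mono_add_left: "mono (v + v') m w n = mono v m w n + mono v' m w n"
  and mono_add_right: "mono v m (w + w') n = mono v m w n + mono v m w' n"
  by (cases v; cases v'; cases w; cases w';
      simp add: monomial_bracket_def bilinear_simps vs1.scale_right_distrib loopA_add loopB_add)+

lemma mono_zero: "mono 0 m w n = 0" "mono v m 0 n = 0"
  using mono_add_left[of 0 0 m w n] mono_add_right[of v m 0 0 n] by simp_all

lemma br_add_left: "br (x + y) z = br x z + br y z"
  unfolding loop_bracket_def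
  by (rule setsum_keys_plus_distrib
      [where f = "\<lambda>m v. \<Sum>n\<in>Poly_Mapping.keys z. mono v m (Poly_Mapping.lookup z n) n"])
    (simp_all add: mono_zero mono_add_left sum.distrib)

lemma br_add_right: "br z (x + y) = br z x + br z y"
  unfolding loop_bracket_def sum.distrib[symmetric]
  by (intro sum.cong refl setsum_keys_plus_distrib
      [where f = "\<lambda>n w. mono (Poly_Mapping.lookup z m) m w n" for m])
    (simp_all add: mono_zero mono_add_right)

lemma br_single: "br (Poly_Mapping.single m v) (Poly_Mapping.single n w) = mono v m w n"
  unfolding loop_bracket_def
  by (subst sum_keys_single
      [where g = "\<lambda>m v. \<Sum>k\<in>Poly_Mapping.keys (Poly_Mapping.single n w).
          mono v m (Poly_Mapping.lookup (Poly_Mapping.single n w) k) k"])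
    (simp_all add: mono_zero sum_keys_single[where g = "\<lambda>k w. mono v m w k"])

lemma br_AA: "br (loopA m a) (loopA n a') = 0"
  and br_AB: "br (loopA m a) (loopB n b) = loopA (m + n) (ab a b)"
  and br_BA: "br (loopB n b) (loopA m a) = loopA (m + n) (ba b a)"
  and br_BB: "br (loopB m b) (loopB n b') =
    loopB (m + n) (bb0 b b') + loopA (m + n - 1) (sA (of_int m) (bb1 b b'))"
  by (simp_all add: br_single monomial_bracket_def bilinear_simps loopA_0 loopB_0 add.commute)

sublocale br_left: additive "\<lambda>x. br x y" for y
  by unfold_locales (rule br_add_left)

sublocale br_right: additive "br x" for x
  by unfold_locales (rule br_add_right)

lemmas br_simps = br_AA br_AB br_BA br_BB br_add_left br_add_right br_left.zero br_right.zero

lemma br_scale_left: "br (scl c x) y = scl c (br x y)"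
proof (induction x rule: loop_induct)
  case (A n a)
  show ?case
    by (induction y rule: loop_induct)
      (simp_all add: br_simps scl_A loop.scale_right_distrib bilinear_simps)
next
  case (B n b)
  show ?case
    by (induction y rule: loop_induct)
      (simp_all add: br_simps scl_A scl_B loop.scale_right_distrib bilinear_simps mult.commute)
qed (simp add: br_simps loop.scale_right_distrib)

lemma br_scale_right: "br x (scl c y) = scl c (br x y)"
proof (induction x rule: loop_induct)
  case (A n a)
  show ?case
    by (induction y rule: loop_induct)
      (simp_all add: br_simps scl_A scl_B loop.scale_right_distrib bilinear_simps)
next
  case (B n b)
  show ?case
    by (induction y rule: loop_induct)
      (simp_all add: br_simps scl_A scl_B loop.scale_right_distrib bilinear_simps mult.commute)
qed (simp add: br_simps loop.scale_right_distrib)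

lemma loop_D_add: "loop_D sA D (f + g) = loop_D sA D f + loop_D sA D g"
  unfolding loop_D_def
  by (rule setsum_keys_plus_distrib
      [where f = "\<lambda>n a. loopB n (D a) + loopA (n - 1) (sA (of_int n) a)"])
    (simp_all add: D.add vs1.scale_right_distrib loopA_add loopB_add loopA_0 loopB_0)

lemma loop_D_single:
  "loop_D sA D (Poly_Mapping.single n a) = loopB n (D a) + loopA (n - 1) (sA (of_int n) a)"
  unfolding loop_D_def
  by (rule sum_keys_single
      [where g = "\<lambda>n a. loopB n (D a) + loopA (n - 1) (sA (of_int n) a)"])
    (simp add: loopA_0 loopB_0)

lemma loop_D_scale: "loop_D sA D (loop_scale sA c f) = scl c (loop_D sA D f)"
proof (induction f rule: poly_mapping_single_induct)
  case (single n a)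
  have "loop_scale sA c (Poly_Mapping.single n a) = Poly_Mapping.single n (sA c a)"
    by (simp add: loop_scale_def)
  then show ?case
    by (simp add: loop_D_single loop.scale_right_distrib scl_A scl_B D.scale mult.commute)
next
  case (add f g)
  interpret LA: vector_space "loop_scale sA"
    by (intro vector_space_loop_scale) unfold_locales
  show ?case
    by (simp add: LA.scale_right_distrib loop_D_add loop.scale_right_distrib add)
qed

abbreviation ideal :: "(int \<Rightarrow>\<^sub>0 'a \<times> 'b) set" where
  "ideal \<equiv> loop_ideal sA D"

lemma loop_D_in_ideal: "loop_D sA D f \<in> ideal"
  by (simp add: loop_ideal_def)

lemma subspace_ideal: "loop.subspace ideal"
proof (rule loop.subspaceI)
  show "0 \<in> ideal"
    using loop_D_in_ideal[of 0] by (simp add: loop_D_def)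
next
  fix x y assume "x \<in> ideal" "y \<in> ideal"
  then show "x + y \<in> ideal"
    by (auto simp: loop_ideal_def simp flip: loop_D_add)
next
  fix c x assume "x \<in> ideal"
  then show "scl c x \<in> ideal"
    by (auto simp: loop_ideal_def simp flip: loop_D_scale)
qed

abbreviation deg :: "int \<Rightarrow> (int \<Rightarrow>\<^sub>0 'a \<times> 'b) set" where
  "deg \<equiv> loop_degree sA sB"

lemma subspace_deg: "loop.subspace (deg d)"
  unfolding loop_degree_def by (rule loop.subspace_span)

lemma A_in_deg: "- n - 1 = d \<Longrightarrow> loopA n a \<in> deg d" and B_in_deg: "- n = d \<Longrightarrow> loopB n b \<in> deg d"
  unfolding loop_degree_def by (rule loop.span_base; blast)+

text \<open>In each degree the loop space has just one copy of \<open>A\<close> and one copy of \<open>B\<close>; this turns the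
  span that defines the degree into a normal form.\<close>

lemma degE:
  assumes "x \<in> deg d"
  obtains a b where "x = loopA (- d - 1) a + loopB (- d) b"
proof -
  let ?S = "{loopA (- d - 1) a + loopB (- d) b | a b. True}"
  have "loop.subspace ?S"
  proof (rule loop.subspaceI)
    show "0 \<in> ?S"
      by (auto intro!: exI[of _ 0] simp: loopA_0 loopB_0)
  next
    fix x y assume "x \<in> ?S" "y \<in> ?S"
    then obtain a b a' b' where "x = loopA (- d - 1) a + loopB (- d) b"
      "y = loopA (- d - 1) a' + loopB (- d) b'" by blast
    then have "x + y = loopA (- d - 1) (a + a') + loopB (- d) (b + b')"
      by (simp add: loopA_add loopB_add)
    then show "x + y \<in> ?S" by blast
  next
    fix c x assume "x \<in> ?S"
    then show "scl c x \<in> ?S"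
      by (fastforce simp: loop.scale_right_distrib scl_A scl_B)
  qed
  moreover have "loopA n a \<in> ?S" if "- n - 1 = d" for n a
  proof -
    have "loopA n a = loopA (- d - 1) a + loopB (- d) 0"
      using that by (auto simp: loopB_0)
    then show ?thesis by blast
  qed
  moreover have "loopB n b \<in> ?S" if "- n = d" for n b
  proof -
    have "loopB n b = loopA (- d - 1) 0 + loopB (- d) b"
      using that by (auto simp: loopA_0)
    then show ?thesis by blast
  qed
  ultimately have "deg d \<subseteq> ?S"
    unfolding loop_degree_def by (intro loop.span_minimal) auto
  then show thesis
    using assms that by blast
qed

definition proj :: "int \<Rightarrow> (int \<Rightarrow>\<^sub>0 'a \<times> 'b) \<Rightarrow> (int \<Rightarrow>\<^sub>0 'a \<times> 'b)" where
  "proj d x = loopA (- d - 1) (fst (Poly_Mapping.lookup x (- d - 1))) +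
    loopB (- d) (snd (Poly_Mapping.lookup x (- d)))"

lemma proj_add: "proj d (x + y) = proj d x + proj d y"
  by (simp add: proj_def lookup_add loopA_add loopB_add)

sublocale proj: additive "proj d" for d
  by unfold_locales (rule proj_add)

lemma proj_in_deg: "proj d x \<in> deg d"
  unfolding proj_def by (intro loop.subspace_add subspace_deg A_in_deg B_in_deg) simp_all

lemma proj_deg: "x \<in> deg m \<Longrightarrow> proj d x = (if d = m then x else 0)"
  by (erule degE) (auto simp: proj_def lookup_add lookup_single when_def loopA_0 loopB_0)

text \<open>The image of \<open>a \<otimes> t\<^sup>n\<close> under the derivation is homogeneous of degree \<open>-n\<close>: the summands
  \<open>D a \<otimes> t\<^sup>n\<close> and \<open>n a \<otimes> t\<^sup>n\<^sup>-\<^sup>1\<close> have the same degree. So the ideal is spanned by homogeneous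
  elements.\<close>

lemma proj_ideal:
  assumes "x \<in> ideal"
  shows "proj d x \<in> ideal"
proof -
  obtain f where x: "x = loop_D sA D f"
    using assms by (auto simp: loop_ideal_def)
  show ?thesis
    unfolding x
  proof (induction f rule: poly_mapping_single_induct)
    case (single n a)
    have "loop_D sA D (Poly_Mapping.single n a) \<in> deg (- n)"
      unfolding loop_D_single by (intro loop.subspace_add subspace_deg A_in_deg B_in_deg) simp_all
    then show ?case
      by (simp add: proj_deg loop_D_in_ideal loop.subspace_0 subspace_ideal)
  qed (simp add: loop_D_add proj_add loop.subspace_add subspace_ideal)
qed

text \<open>The key \<open>n\<close> of \<open>x\<close> contributes to the two degrees \<open>-n-1\<close> and \<open>-n\<close>, which gives the finite
  set of degrees.\<close>

lemma deg_decomposition: "\<exists>S. finite S \<and> (\<forall>d. d \<notin> S \<longrightarrow> proj d x = 0) \<and> x = (\<Sum>d\<in>S. proj d x)"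
proof -
  let ?S = "(\<lambda>n. - n - 1) ` Poly_Mapping.keys x \<union> uminus ` Poly_Mapping.keys x"
  have fin: "finite ?S"
    by simp
  have A: "Poly_Mapping.lookup x (- d - 1) = 0" and B: "Poly_Mapping.lookup x (- d) = 0"
    if "d \<notin> ?S" for d
    using that by (force simp: in_keys_iff image_iff)+
  have "x = (\<Sum>d\<in>?S. proj d x)"
  proof (rule poly_mapping_eqI)
    fix n
    have "Poly_Mapping.lookup (\<Sum>d\<in>?S. proj d x) n =
        (\<Sum>d\<in>?S. (if d = - n - 1 then (fst (Poly_Mapping.lookup x n), 0) else 0) +
          (if d = - n then (0, snd (Poly_Mapping.lookup x n)) else 0))"
      unfolding lookup_sum
      by (intro sum.cong refl) (auto simp: proj_def lookup_add lookup_single when_def)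
    also have "\<dots> = (if - n - 1 \<in> ?S then (fst (Poly_Mapping.lookup x n), 0) else 0) +
        (if - n \<in> ?S then (0, snd (Poly_Mapping.lookup x n)) else 0)"
      by (simp only: sum.distrib sum.delta fin)
    also have "\<dots> = Poly_Mapping.lookup x n"
      using A[of "- n - 1"] B[of "- n"] by (auto simp: prod_eq_iff)
    finally show "Poly_Mapping.lookup x n = Poly_Mapping.lookup (\<Sum>d\<in>?S. proj d x) n" ..
  qed
  moreover have "\<forall>d. d \<notin> ?S \<longrightarrow> proj d x = 0"
    using A B by (auto simp: proj_def loopA_0 loopB_0)
  ultimately show ?thesis
    using fin by blast
qed

lemma br_deg:
  assumes "x \<in> deg m" "y \<in> deg n"
  shows "br x y \<in> deg (m + n)"
proof -
  obtain a b a' b' where "x = loopA (- m - 1) a + loopB (- m) b"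
    "y = loopA (- n - 1) a' + loopB (- n) b'"
    using assms degE by metis
  then show ?thesis
    by (simp only: br_simps)
      (intro loop.subspace_add subspace_deg A_in_deg B_in_deg loop.subspace_0; simp)
qed

end

section \<open>From the relations to the conformal algebra axioms\<close>

lemma total_prod_simps:
  "total_prod ab ba bb0 bb1 0 x y =
    (ab (fst x) (snd y) + ba (snd x) (fst y), bb0 (snd x) (snd y))"
  "total_prod ab ba bb0 bb1 (Suc 0) x y = (bb1 (snd x) (snd y), 0)"
  by (simp_all add: total_prod_def split: prod.split)

lemma bilinear_mapI:
  assumes "vector_space s1" "vector_space s2" "vector_space s3"
    and "\<And>x x' y. f (x + x') y = f x y + f x' y" "\<And>x y y'. f x (y + y') = f x y + f x y'"
    and "\<And>c x y. f (s1 c x) y = s3 c (f x y)" "\<And>c x y. f x (s2 c y) = s3 c (f x y)"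
  shows "bilinear_map s1 s2 s3 f"
  unfolding bilinear_map_def Vector_Spaces.linear_iff using assms by blast

lemma (in truncated_operations) bilinear_total_prod:
  assumes "i \<in> {0, 1}"
  shows "bilinear_map scale scale scale (total_prod ab ba bb0 bb1 i)"
proof -
  note simps = total_prod_simps scale_def fst_add snd_add fst_conv snd_conv bilinear_simps
    vs1.scale_right_distrib
  have "bilinear_map scale scale scale (total_prod ab ba bb0 bb1 0)"
    by (rule bilinear_mapI; (rule p.vector_space_axioms | (simp only: simps; simp)))
  moreover have "bilinear_map scale scale scale (total_prod ab ba bb0 bb1 (Suc 0))"
    by (rule bilinear_mapI; (rule p.vector_space_axioms | (simp only: simps; simp)))
  ultimately show ?thesis
    using assms by auto
qed

locale truncated_relations = truncated_operations sA sB D ab ba bb0 bb1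
  for sA :: "complex \<Rightarrow> 'a::ab_group_add \<Rightarrow> 'a"
    and sB :: "complex \<Rightarrow> 'b::ab_group_add \<Rightarrow> 'b"
    and D ab ba bb0 bb1 +
  assumes ab_D: "ab a (D a') = 0"
    and bb0_D: "bb0 b (D a) = D (ba b a)"
    and bb1_D: "bb1 b (D a) = ba b a"
    and D_ba: "ba (D a) a' = 0"
    and D_bb0: "bb0 (D a) b = 0"
    and D_bb1: "bb1 (D a) b = - ab a b"
    and ab_eq: "ab a b = - ba b a"
    and bb1_commute: "bb1 b b' = bb1 b' b"
    and bb0_commute: "bb0 b b' = - bb0 b' b + D (bb1 b' b)"
    and ab_assoc: "ab a (bb0 u v) - ba u (ab a v) = ab (ab a u) v"
    and bb0_assoc: "bb0 u (bb0 v w) - bb0 v (bb0 u w) = bb0 (bb0 u v) w"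
    and bb1_assoc: "ba u (bb1 v w) - bb1 v (bb0 u w) = bb1 (bb0 u v) w"
begin

text \<open>The assumption \<open>ab_assoc\<close> is associativity with the factor from \<open>A\<close> in front of two
  factors from \<open>B\<close>. Replacing \<open>a\<^sub>0b\<close> by \<open>-b\<^sub>0a\<close> yields the cases with that
  factor in the second or third place.\<close>

lemma ab_assoc_AB: "ab a (bb0 u v) = ba u (ab a v) + ab (ab a u) v"
  by (simp flip: ab_assoc)

lemma ab_assoc_BA: "ba u (ab a v) = ab a (bb0 u v) + ab (ba u a) v"
  using ab_assoc[of a u v] by (simp add: ab_eq[of a u] bilinear_simps algebra_simps)

lemma ba_assoc: "ba u (ba v a) = ba v (ba u a) + ba (bb0 u v) a"
  using ab_assoc[of a u v] by (simp add: ab_eq bilinear_simps algebra_simps)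

text \<open>Most axioms are relations read componentwise. The associativity axiom ranges over
  inhomogeneous triples; its \<open>A\<close>-component for \<open>i = 0\<close> splits into the three orderings just
  established.\<close>

lemma one_truncated_conformal_algebra:
  "one_truncated_conformal_algebra sA sB D (total_prod ab ba bb0 bb1)"
proof (unfold_locales, goal_cases)
  case (1 i)
  then show ?case by (rule bilinear_total_prod)
next
  case (2 i u p v q)
  then have "i = 0 \<or> i = Suc 0"
    by auto
  with 2(2,3) show ?case
    by (cases u; cases v)
      (auto simp: homogeneous_def total_prod_simps bilinear_simps prod_eq_iff split: if_splits)
next
  case (3 a x)
  show ?case by (simp add: total_prod_simps prod_eq_iff D_ba D_bb0 bilinear_simps)
next
  case (4 a x)
  show ?case by (simp add: total_prod_simps prod_eq_iff D_bb1 bilinear_simps)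
next
  case (5 u a)
  show ?case by (simp add: total_prod_simps prod_eq_iff bb0_D bilinear_simps)
next
  case (6 u a)
  show ?case by (simp add: total_prod_simps prod_eq_iff ab_eq[of a u] bilinear_simps)
next
  case (7 u v)
  show ?case using bb0_commute[of u v] by (simp add: total_prod_simps prod_eq_iff bilinear_simps)
next
  case (8 u v)
  show ?case by (simp add: total_prod_simps bb1_commute[of u v])
next
  case (9 i x y z)
  then have "i = 0 \<or> i = Suc 0"
    by auto
  then show ?case
    by (elim disjE)
      (simp_all add: total_prod_simps prod_eq_iff bilinear_simps
        ab_assoc_AB[of "fst x" "snd y" "snd z"] ab_assoc_BA[of "snd x" "fst y" "snd z"]
        ba_assoc[of "snd x" "snd y" "fst z"] bb0_assoc[symmetric] bb1_assoc[symmetric])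
qed

section \<open>The loop bracket under the relations\<close>

text \<open>On generators only the triples with at most one factor from \<open>A\<close> give nonzero products. If
  there is such a factor, the identity is associativity. For three factors from \<open>B\<close> it is an
  identity between polynomials in the exponents \<open>m\<close> and \<open>n\<close>, whose coefficients are compared
  separately.\<close>

lemma leibniz: "br x (br y z) = br y (br x z) + br (br x y) z"
proof (induction x rule: loop_induct)
  case (A m a)
  show ?case
  proof (induction y rule: loop_induct)
    case (A n a')
    show ?case
      by (induction z rule: loop_induct) (simp_all add: br_simps)
  next
    case (B n u)
    show ?case
      by (induction z rule: loop_induct)
        (simp_all add: br_simps bilinear_simps ab_assoc_AB loopA_add algebra_simps)
  qed (simp add: br_simps)
next
  case (B m u)
  show ?case
  proof (induction y rule: loop_induct)
    case (A n a)
    show ?case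
      by (induction z rule: loop_induct)
        (simp_all add: br_simps bilinear_simps ab_assoc_BA loopA_add algebra_simps)
  next
    case (B n v)
    show ?case
    proof (induction z rule: loop_induct)
      case (A k a)
      show ?case
        by (simp add: br_simps ba_assoc[of u v] loopA_add algebra_simps)
    next
      case (B k w)
      \<comment> \<open>The part in which no exponent occurs, then the coefficients of \<open>n\<close> and of \<open>m\<close>.\<close>
      have 0: "bb0 u (bb0 v w) = bb0 v (bb0 u w) + bb0 (bb0 u v) w"
        by (simp flip: bb0_assoc)
      have n: "ba u (bb1 v w) = bb1 v (bb0 u w) + bb1 (bb0 u v) w"
        by (simp flip: bb1_assoc)
      \<comment> \<open>Associativity for \<open>v, u, w\<close> produces \<open>(v\<^sub>0u)\<^sub>1w\<close>; reversing \<open>v\<^sub>0u\<close> costs the derivation of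
        \<open>u\<^sub>1v\<close>, which acts through \<open>D_bb1\<close>.\<close>
      have m: "bb1 u (bb0 v w) = ba v (bb1 u w) + bb1 (bb0 u v) w + ab (bb1 u v) w"
        using bb1_assoc[of v u w]
        by (simp add: bb0_commute[of v u] bilinear_simps D_bb1 algebra_simps)
      show ?case
        by (simp add: br_simps bilinear_simps 0 m n loopA_add loopB_add vs1.scale_right_distrib
            vs1.scale_left_distrib algebra_simps)
    qed (simp add: br_simps)
  qed (simp add: br_simps)
qed (simp add: br_simps)

text \<open>Left multiplication by an element of the ideal is zero, not merely zero modulo the ideal:
  \<open>(D a)\<^sub>0\<close> vanishes and \<open>(D a)\<^sub>1b = -a\<^sub>0b\<close> cancels the term that stems from differentiating \<open>t\<^sup>n\<close>.\<close>

lemma loop_D_br: "br (loop_D sA D f) y = 0"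
proof (induction f rule: poly_mapping_single_induct)
  case (single n a)
  show ?case
    by (induction y rule: loop_induct)
      (simp_all add: loop_D_single br_simps bilinear_simps D_ba D_bb0 D_bb1 loopA_0 loopB_0
        flip: loopA_add, simp_all add: loopB_0 algebra_simps flip: loopA_add)
qed (simp add: loop_D_add br_simps)

text \<open>The ideal is stable under left multiplication: generators from \<open>A\<close> annihilate it, and
  \<open>b \<otimes> t\<^sup>m\<close> maps the image of \<open>a \<otimes> t\<^sup>n\<close> under the derivation to the image of
  \<open>b\<^sub>0a \<otimes> t\<^sup>m\<^sup>+\<^sup>n\<close>.\<close>

lemma br_loop_D_in_ideal: "br x (loop_D sA D f) \<in> ideal"
proof (induction f rule: poly_mapping_single_induct)
  case (single n a)
  show ?case
  proof (induction x rule: loop_induct)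
    case (A m a')
    show ?case
      by (simp add: loop_D_single br_simps ab_D loopA_0 loop.subspace_0 subspace_ideal)
  next
    case (B m b)
    have "br (loopB m b) (loop_D sA D (Poly_Mapping.single n a)) =
        loop_D sA D (Poly_Mapping.single (m + n) (ba b a))"
      by (simp add: loop_D_single br_simps bilinear_simps bb0_D bb1_D vs1.scale_left_distrib
          loopA_add algebra_simps)
    then show ?case
      by (simp add: loop_D_in_ideal)
  qed (simp add: br_simps loop.subspace_add subspace_ideal)
qed (simp add: loop_D_add br_simps loop.subspace_add subspace_ideal)

text \<open>The defect \<open>D (b'\<^sub>1b)\<close> of skew-symmetry of \<open>b\<^sub>0b'\<close> and the terms \<open>m (b\<^sub>1b')\<close> and \<open>n (b'\<^sub>1b)\<close> of the
  two brackets combine to the image of \<open>b\<^sub>1b' \<otimes> t\<^sup>m\<^sup>+\<^sup>n\<close> under the derivation.\<close>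

lemma br_skew_in_ideal: "br x y + br y x \<in> ideal"
proof (induction x rule: loop_induct)
  case (A m a)
  show ?case
  proof (induction y rule: loop_induct)
    case (B n b)
    have "br (loopA m a) (loopB n b) + br (loopB n b) (loopA m a) = 0"
      by (simp add: br_simps ab_eq loopA_0 flip: loopA_add)
    then show ?case
      by (simp only: loop.subspace_0 subspace_ideal)
  next
    case (add x y)
    then show ?case
      using loop.subspace_add[OF subspace_ideal add] by (simp add: br_simps add_ac)
  qed (simp add: br_simps loop.subspace_0 subspace_ideal)
next
  case (B m b)
  show ?case
  proof (induction y rule: loop_induct)
    case (A n a)
    have "br (loopA n a) (loopB m b) + br (loopB m b) (loopA n a) = 0"
      by (simp add: br_simps ab_eq loopA_0 flip: loopA_add)
    then show ?case
      by (simp add: loop.subspace_0 subspace_ideal add.commute)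
  next
    case (B n b')
    have "br (loopB m b) (loopB n b') + br (loopB n b') (loopB m b) =
        loop_D sA D (Poly_Mapping.single (m + n) (bb1 b b'))"
      by (simp add: loop_D_single br_simps bb0_commute[of b b'] bb1_commute[of b' b]
          vs1.scale_left_distrib loopA_add loopB_diff algebra_simps)
    then show ?case
      by (simp only: loop_D_in_ideal)
  next
    case (add x y)
    then show ?case
      using loop.subspace_add[OF subspace_ideal add] by (simp add: br_simps add_ac)
  qed
next
  case (add x x')
  then show ?case
    using loop.subspace_add[OF subspace_ideal add] by (simp add: br_simps add_ac)
qed

lemma br_square_in_ideal: "br x x \<in> ideal"
proof -
  have "br x x = scl (1 / 2) (scl 2 (br x x))"
    by simp
  also have "scl 2 (br x x) = br x x + br x x"
    using loop.scale_left_distrib[of 1 1] by simp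
  finally show ?thesis
    using loop.subspace_scale[OF subspace_ideal br_skew_in_ideal[of x x]] by metis
qed

sublocale graded_leibniz_algebra_ideal scl br ideal deg proj
proof unfold_locales
  fix i x assume "i \<in> ideal"
  then obtain f where "i = loop_D sA D f"
    by (auto simp: loop_ideal_def)
  then show "br x i \<in> ideal" "br i x \<in> ideal"
    by (simp_all add: br_loop_D_in_ideal loop_D_br loop.subspace_0 subspace_ideal)
qed (fact br_add_left br_add_right br_scale_left br_scale_right leibniz subspace_ideal
    br_square_in_ideal subspace_deg br_deg proj_in_deg proj_deg proj_ideal deg_decomposition proj_add)+

lemma int_graded_lie_algebra_quotient_loop_algebra:
  "int_graded_lie_algebra (ring_of_type_algebra :: complex ring)
    (quotient_loop_algebra sA sB D ab ba bb0 bb1) (quotient_degree sA sB D ab ba bb0 bb1)"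
proof -
  have alg: "loop_algebra sA sB ab ba bb0 bb1 = alg"
    by (simp add: loop_algebra_def alg_def)
  have "quotient_degree sA sB D ab ba bb0 bb1 = quot_G"
    by (simp add: fun_eq_iff quotient_degree_def alg coset_def)
  then show ?thesis
    using int_graded_lie_algebra_quot by (simp add: quotient_loop_algebra_def alg)
qed

end

section \<open>The characterization and the graded Lie algebra\<close>

text \<open>Each relation is an axiom evaluated at pure elements, except for the two relations
  \<open>a\<^sub>0 D a' = 0\<close> and \<open>b\<^sub>1 D a = b\<^sub>0a\<close>, which follow from \<open>D_ba\<close> and \<open>D_bb1\<close> by commutativity.\<close>

lemma (in truncated_operations) truncated_relationsI:
  assumes "one_truncated_conformal_algebra sA sB D (total_prod ab ba bb0 bb1)"
  shows "truncated_relations sA sB D ab ba bb0 bb1"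
proof -
  interpret C: one_truncated_conformal_algebra sA sB D "total_prod ab ba bb0 bb1" by fact
  note simps = total_prod_simps bilinear_simps
  have D_ba: "ba (D a) a' = 0" for a a'
    using C.derivation_0[of a "(a', 0)"] by (simp add: simps prod_eq_iff)
  have D_bb0: "bb0 (D a) b = 0" for a b
    using C.derivation_0[of a "(0, b)"] by (simp add: simps prod_eq_iff)
  have D_bb1: "bb1 (D a) b = - ab a b" for a b
    using C.derivation_1[of a "(0, b)"] by (simp add: simps prod_eq_iff)
  have bb0_D: "bb0 b (D a) = D (ba b a)" for b a
    using C.derivation_D[of b a] by (simp add: simps prod_eq_iff)
  have ab_eq: "ab a b = - ba b a" for a b
    using C.commutativity_10[of b a] by (simp add: simps prod_eq_iff)
  have bb1_commute: "bb1 b b' = bb1 b' b" for b b'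
    using C.commutativity_1[of b b'] by (simp add: simps prod_eq_iff)
  have bb0_commute: "bb0 b b' = - bb0 b' b + D (bb1 b' b)" for b b'
    using C.commutativity_11[of b b'] by (simp add: simps prod_eq_iff)
  have ab_assoc: "ab a (bb0 u v) - ba u (ab a v) = ab (ab a u) v" for a u v
    using C.associativity[of 0 "(a, 0)" "(0, u)" "(0, v)"] by (simp add: simps prod_eq_iff)
  have bb0_assoc: "bb0 u (bb0 v w) - bb0 v (bb0 u w) = bb0 (bb0 u v) w" for u v w
    using C.associativity[of 0 "(0, u)" "(0, v)" "(0, w)"] by (simp add: simps prod_eq_iff)
  have bb1_assoc: "ba u (bb1 v w) - bb1 v (bb0 u w) = bb1 (bb0 u v) w" for u v w
    using C.associativity[of 1 "(0, u)" "(0, v)" "(0, w)"] by (simp add: simps prod_eq_iff)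
  show ?thesis
    by unfold_locales
      (fact D_ba D_bb0 D_bb1 bb0_D ab_eq bb1_commute bb0_commute ab_assoc bb0_assoc bb1_assoc |
        simp add: ab_eq D_ba D_bb1 bb1_commute[of _ "D _"])+
qed

theorem theorem3p4:
  fixes sA :: "complex \<Rightarrow> 'a::ab_group_add \<Rightarrow> 'a"
    and sB :: "complex \<Rightarrow> 'b::ab_group_add \<Rightarrow> 'b"
    and D :: "'a \<Rightarrow> 'b"
    and ab :: "'a \<Rightarrow> 'b \<Rightarrow> 'a"
    and ba :: "'b \<Rightarrow> 'a \<Rightarrow> 'a"
    and bb0 :: "'b \<Rightarrow> 'b \<Rightarrow> 'b"
    and bb1 :: "'b \<Rightarrow> 'b \<Rightarrow> 'a"
  assumes "vector_space sA" and "vector_space sB"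
    and "Vector_Spaces.linear sA sB D"
    and "bilinear_map sA sB sA ab"
    and "bilinear_map sB sA sA ba"
    and "bilinear_map sB sB sB bb0"
    and "bilinear_map sB sB sA bb1"
  shows "(one_truncated_conformal_algebra sA sB D (total_prod ab ba bb0 bb1) \<longleftrightarrow>
      \<comment> \<open>(i)\<close>
      ((\<forall>a a'. ab a (D a') = 0) \<and>
       (\<forall>b a'. bb0 b (D a') = D (ba b a')) \<and>
       (\<forall>b a'. bb1 b (D a') = ba b a') \<and>
       (\<forall>a a'. ba (D a) a' = 0) \<and>
       (\<forall>a b. bb0 (D a) b = 0) \<and>
       (\<forall>a b. bb1 (D a) b = - ab a b)) \<and>
      \<comment> \<open>(ii)\<close>
      ((\<forall>a b. ab a b = - ba b a) \<and>
       (\<forall>b b'. bb1 b b' = bb1 b' b) \<and>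
       (\<forall>b b'. bb0 b b' = - bb0 b' b + D (bb1 b' b))) \<and>
      \<comment> \<open>(iii)\<close>
      ((\<forall>a u v. ab a (bb0 u v) - ba u (ab a v) = ab (ab a u) v) \<and>
       (\<forall>u v w. bb0 u (bb0 v w) - bb0 v (bb0 u w) = bb0 (bb0 u v) w) \<and>
       (\<forall>u v w. ba u (bb1 v w) - bb1 v (bb0 u w) = bb1 (bb0 u v) w))) \<and>
    (one_truncated_conformal_algebra sA sB D (total_prod ab ba bb0 bb1) \<longrightarrow>
      int_graded_lie_algebra (ring_of_type_algebra :: complex ring)
        (quotient_loop_algebra sA sB D ab ba bb0 bb1)
        (quotient_degree sA sB D ab ba bb0 bb1))"
proof -
  interpret truncated_operations sA sB D ab ba bb0 bb1
    by (intro truncated_operations.intro vector_space_prod.intro vector_space_pair.intro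
        truncated_operations_axioms.intro assms)
  have iff: "one_truncated_conformal_algebra sA sB D (total_prod ab ba bb0 bb1) \<longleftrightarrow>
      truncated_relations sA sB D ab ba bb0 bb1"
    using truncated_relationsI truncated_relations.one_truncated_conformal_algebra by blast
  have lie: "truncated_relations sA sB D ab ba bb0 bb1 \<longrightarrow>
      int_graded_lie_algebra (ring_of_type_algebra :: complex ring)
        (quotient_loop_algebra sA sB D ab ba bb0 bb1) (quotient_degree sA sB D ab ba bb0 bb1)"
    using truncated_relations.int_graded_lie_algebra_quotient_loop_algebra by blast
  \<comment> \<open>The locale predicate carries the given linearity hypotheses \<open>T\<close> as an additional conjunct.\<close>
  have split: "(P \<longleftrightarrow> R) \<and> (P \<longrightarrow> Q)" if "P \<longleftrightarrow> T \<and> R" "T \<and> R \<longrightarrow> Q" T for P Q R T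
    using that by blast
  show ?thesis
    using iff lie truncated_operations_axioms
    unfolding truncated_relations_def truncated_relations_axioms_def conj_assoc
    by (rule split)
qed

end
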